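(* Let $\mathsf{W}$ be a weak equivalence set on a finite lattice $P$. Then $$\mathsf{AF}_{min}=\mathrm{RLP}(K_{max})\cap\mathsf{W}\quad\text{and}\quad \mathsf{AC}_{min}=\mathrm{LLP}(T_{max})\cap\mathsf{W}.$$ Similarly, $$T_{max}=\mathrm{RLP}(\mathsf{AC}_{min})\cap\mathsf{W}\quad\text{and}\quad K_{max}=\mathrm{LLP}(\mathsf{AF}_{min})\cap\mathsf{W}.$$
   Context: A finite lattice $P$ is regarded as a category whose objects are the elements of $P$, with a unique arrow $a\to b$ whenever $a\le b$. A wide subcategory is one containing all objects; a subcategory $D$ of $P$ is decomposable if whenever $f,g$ are composable morphisms of $P$ with $g\circ f\in D$, then $f\in D$ and $g\in D$. Wide subcategories are identified with their collections of morphisms. A transfer system on $P$ is a partial order $R$ on the set $P$ such that $xRy$ implies $x\le y$, and $xRy$, $z\le y$ imply $(x\wedge z)Rz$; equivalently, a wide subcategory of $P$ closed under pullbacks. A cotransfer system on $P$ is a partial order $R$ such that $xRy$ implies $x\le y$, and $xRy$, $x\le z$ imply $zR(y\vee z)$; equivalently, a wide subcategory closed under pushouts. Ordered by inclusion, transfer systems form a lattice and cotransfer systems form a lattice: meets are intersections, and joins are the smallest (co)transfer systems containing the union. For arrows $i\colon a\to b$ and $p\colon x\to y$, $i$ has the left lifting property with respect to $p$ (and $p$ the right lifting property with respect to $i$) if every commutative square from $i$ to $p$ has a diagonal lift $b\to x$. For a class $S$ of morphisms, $\mathrm{LLP}(S)$ (written ${}^{\square}S$ with a slashed box in the paper) is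 the class of morphisms of $P$ with the left lifting property with respect to all of $S$, and $\mathrm{RLP}(S)$ the class of morphisms with the right lifting property with respect to all of $S$. A weak factorization system on $P$ is a pair $(L,R)$ of classes of morphisms such that every morphism factors as $p\circ i$ with $i\in L$, $p\in R$, and $L=\mathrm{LLP}(R)$, $R=\mathrm{RLP}(L)$. A model structure on $P$ consists of two weak factorization systems $(\mathsf{AC},\mathsf{F})$ and $(\mathsf{C},\mathsf{AF})$ with $\mathsf{AC}\subseteq\mathsf{C}$ such that $\mathsf{W}:=\mathsf{AF}\circ\mathsf{AC}=\{p\circ i: i\in\mathsf{AC},\,p\in\mathsf{AF}\}$ (the weak equivalences) satisfies the two-out-of-three axiom; $\mathsf{AF}$ are the acyclic fibrations and $\mathsf{AC}$ the acyclic cofibrations. A wide decomposable subcategory $\mathsf{W}$ of $P$ is a weak equivalence set if there is a model structure on $P$ with weak equivalences $\mathsf{W}$. $\mathrm{AF}(\mathsf{W})$ (resp. $\mathrm{AC}(\mathsf{W})$) is the set of transfer systems (resp. cotransfer systems) contained in $\mathsf{W}$ that form the acyclic fibrations (resp. acyclic cofibrations) of a model structure on $P$ with weak equivalences $\mathsf{W}$. $\mathsf{AF}_{min}$ (resp. $\mathsf{AC}_{min}$) is the meet, i.e. intersection, of all elements of $\mathrm{AF}(\mathsf{W})$ (resp. $\mathrm{AC}(\mathsf{W})$). $T_{max}$ is the join of all transfer systems on $P$ contained in $\mathsf{W}$, and $K_{max}$ is the join of all cotransfer systems on $P$ contained in $\mathsf{W}$. *)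

theory Defs
  imports Main
begin

text \<open>
  A lattice, seen as a category, has at most one arrow between any two objects. The arrow
  from \<open>a\<close> to \<open>b\<close> is encoded as the pair \<open>(a, b)\<close> with \<open>a \<le> b\<close>, and a class of morphisms is a
  set of such pairs. All diagrams commute automatically.
\<close>

definition arrows :: "('a::order) rel" where
  "arrows = {(a, b). a \<le> b}"

definition wide_subcategory :: "('a::order) rel \<Rightarrow> bool" where
  "wide_subcategory D \<longleftrightarrow> D \<subseteq> arrows \<and> refl D \<and> trans D"

definition decomposable :: "('a::order) rel \<Rightarrow> bool" where
  "decomposable D \<longleftrightarrow>
     (\<forall>a b c. (a, b) \<in> arrows \<longrightarrow> (b, c) \<in> arrows \<longrightarrow> (a, c) \<in> D \<longrightarrow> (a, b) \<in> D \<and> (b, c) \<in> D)"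

definition transfer_system :: "('a::lattice) rel \<Rightarrow> bool" where
  "transfer_system R \<longleftrightarrow>
     partial_order_on UNIV R \<and> (\<forall>x y. (x, y) \<in> R \<longrightarrow> x \<le> y) \<and>
     (\<forall>x y z. (x, y) \<in> R \<longrightarrow> z \<le> y \<longrightarrow> (inf x z, z) \<in> R)"

definition cotransfer_system :: "('a::lattice) rel \<Rightarrow> bool" where
  "cotransfer_system R \<longleftrightarrow>
     partial_order_on UNIV R \<and> (\<forall>x y. (x, y) \<in> R \<longrightarrow> x \<le> y) \<and>
     (\<forall>x y z. (x, y) \<in> R \<longrightarrow> x \<le> z \<longrightarrow> (z, sup y z) \<in> R)"

definition transfer_join :: "('a::lattice) rel set \<Rightarrow> 'a rel" where
  "transfer_join \<S> = \<Inter>{T. transfer_system T \<and> \<Union>\<S> \<subseteq> T}"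

definition cotransfer_join :: "('a::lattice) rel set \<Rightarrow> 'a rel" where
  "cotransfer_join \<S> = \<Inter>{K. cotransfer_system K \<and> \<Union>\<S> \<subseteq> K}"

text \<open>
  A commutative square from \<open>i : a \<rightarrow> b\<close> to \<open>p : x \<rightarrow> y\<close> amounts to \<open>a \<le> x\<close> and \<open>b \<le> y\<close>;
  a diagonal lift amounts to \<open>b \<le> x\<close>.
\<close>

fun has_lift :: "('a::order) \<times> 'a \<Rightarrow> 'a \<times> 'a \<Rightarrow> bool" where
  "has_lift (a, b) (x, y) \<longleftrightarrow> (a \<le> x \<longrightarrow> b \<le> y \<longrightarrow> b \<le> x)"

definition LLP :: "('a::order) rel \<Rightarrow> 'a rel" where
  "LLP S = {i \<in> arrows. \<forall>p \<in> S. has_lift i p}"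

definition RLP :: "('a::order) rel \<Rightarrow> 'a rel" where
  "RLP S = {p \<in> arrows. \<forall>i \<in> S. has_lift i p}"

text \<open>
  Relational composition \<open>L O R\<close> is in diagrammatic order: its elements are the
  composites \<open>p \<circ> i\<close> with \<open>i \<in> L\<close> and \<open>p \<in> R\<close>.
\<close>

definition weak_factorization_system :: "('a::order) rel \<Rightarrow> 'a rel \<Rightarrow> bool" where
  "weak_factorization_system L R \<longleftrightarrow> arrows \<subseteq> L O R \<and> L = LLP R \<and> R = RLP L"

definition two_out_of_three :: "('a::order) rel \<Rightarrow> bool" where
  "two_out_of_three W \<longleftrightarrow>
     (\<forall>a b c. (a, b) \<in> arrows \<longrightarrow> (b, c) \<in> arrows \<longrightarrow>
        ((a, b) \<in> W \<and> (b, c) \<in> W \<longrightarrow> (a, c) \<in> W) \<and>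
        ((a, b) \<in> W \<and> (a, c) \<in> W \<longrightarrow> (b, c) \<in> W) \<and>
        ((b, c) \<in> W \<and> (a, c) \<in> W \<longrightarrow> (a, b) \<in> W))"

definition weak_equivalences :: "'a rel \<Rightarrow> 'a rel \<Rightarrow> 'a rel" where
  "weak_equivalences AC AF = AC O AF"

definition model_structure ::
    "('a::order) rel \<Rightarrow> 'a rel \<Rightarrow> 'a rel \<Rightarrow> 'a rel \<Rightarrow> bool" where
  "model_structure AC F C AF \<longleftrightarrow>
     weak_factorization_system AC F \<and> weak_factorization_system C AF \<and> AC \<subseteq> C \<and>
     two_out_of_three (weak_equivalences AC AF)"

definition weak_equivalence_set :: "('a::order) rel \<Rightarrow> bool" where
  "weak_equivalence_set W \<longleftrightarrow>
     wide_subcategory W \<and> decomposable W \<and>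
     (\<exists>AC F C AF. model_structure AC F C AF \<and> weak_equivalences AC AF = W)"

definition AF_set :: "('a::lattice) rel \<Rightarrow> 'a rel set" where
  "AF_set W = {AF. transfer_system AF \<and> AF \<subseteq> W \<and>
     (\<exists>AC F C. model_structure AC F C AF \<and> weak_equivalences AC AF = W)}"

definition AC_set :: "('a::lattice) rel \<Rightarrow> 'a rel set" where
  "AC_set W = {AC. cotransfer_system AC \<and> AC \<subseteq> W \<and>
     (\<exists>F C AF. model_structure AC F C AF \<and> weak_equivalences AC AF = W)}"

definition AF_min :: "('a::lattice) rel \<Rightarrow> 'a rel" where
  "AF_min W = \<Inter>(AF_set W)"

definition AC_min :: "('a::lattice) rel \<Rightarrow> 'a rel" where
  "AC_min W = \<Inter>(AC_set W)"

definition T_max :: "('a::lattice) rel \<Rightarrow> 'a rel" where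
  "T_max W = transfer_join {T. transfer_system T \<and> T \<subseteq> W}"

definition K_max :: "('a::lattice) rel \<Rightarrow> 'a rel" where
  "K_max W = cotransfer_join {K. cotransfer_system K \<and> K \<subseteq> W}"

end

theory Submission
  imports Defs
begin

text \<open>
  Taking lifting classes inside \<open>W\<close> is an order-reversing bijection between \<open>AF_set W\<close> and
  \<open>AC_set W\<close>: in a
  model structure with weak equivalences \<open>W\<close>, the retract argument gives \<open>AC = LLP AF \<inter> W\<close> and
  \<open>AF = RLP AC \<inter> W\<close>, and, \<open>W\<close> being decomposable, these two equations between a cotransfer system
  and a transfer system conversely yield a model structure
  (\<open>model_structure_iff_acyclic_pair\<close>). So the smallest element on one side corresponds to the
  largest element on the other, and all four equations follow once \<open>T_max W\<close> and \<open>K_max W\<close> are known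
  to be the largest elements of \<open>AF_set W\<close> and \<open>AC_set W\<close>.

  They are for two reasons. First, the join of transfer systems is the transitive closure of their
  union, because pulling back a chain of arrows pulls back each of its links; so \<open>T_max W\<close> still
  lies in the subcategory \<open>W\<close> and is the largest transfer system that does. Secondly, \<open>AF_set W\<close> is
  upward closed among the transfer systems inside \<open>W\<close> (\<open>acyclic_pair_enlarge_transfer\<close>). The only
  obstruction to a transfer system \<open>T \<subseteq> W\<close> being the acyclic fibrations of a model structure with
  weak equivalences \<open>W\<close> is that pushouts of \<open>LLP T \<inter> W\<close> may leave \<open>W\<close>; enlarging \<open>T\<close> shrinks this class, so the pushouts stay in \<open>W\<close>
  if they did before. The arguments for \<open>K_max W\<close> are dual.
\<close>

section \<open>Lifting properties and (co)transfer systems\<close>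

lemma LLP_subset_arrows: "LLP S \<subseteq> arrows"
  by (auto simp: LLP_def)

lemma RLP_subset_arrows: "RLP S \<subseteq> arrows"
  by (auto simp: RLP_def)

lemma RLP_antimono: "S \<subseteq> T \<Longrightarrow> RLP T \<subseteq> RLP S"
  by (auto simp: RLP_def)

lemma LLP_antimono: "S \<subseteq> T \<Longrightarrow> LLP T \<subseteq> LLP S"
  by (auto simp: LLP_def)

lemma subset_RLP_iff_subset_LLP:
  assumes "L \<subseteq> arrows" and "R \<subseteq> arrows"
  shows "R \<subseteq> RLP L \<longleftrightarrow> L \<subseteq> LLP R"
  using assms by (auto simp: RLP_def LLP_def)

lemma antisym_arrows: "antisym arrows"
  by (rule antisymI) (simp add: arrows_def)

lemma transfer_systemI:
  assumes "R \<subseteq> arrows" and "refl R" and "trans R"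
    and "\<And>x y z. (x, y) \<in> R \<Longrightarrow> z \<le> y \<Longrightarrow> (inf x z, z) \<in> R"
  shows "transfer_system R"
proof -
  have "antisym R"
    using assms(1) antisym_subset[OF _ antisym_arrows] by blast
  then show ?thesis
    using assms by (auto simp: transfer_system_def partial_order_on_def preorder_on_def arrows_def)
qed

lemma cotransfer_systemI:
  assumes "R \<subseteq> arrows" and "refl R" and "trans R"
    and "\<And>x y z. (x, y) \<in> R \<Longrightarrow> x \<le> z \<Longrightarrow> (z, sup y z) \<in> R"
  shows "cotransfer_system R"
proof -
  have "antisym R"
    using assms(1) antisym_subset[OF _ antisym_arrows] by blast
  then show ?thesis
    using assms by (auto simp: cotransfer_system_def partial_order_on_def preorder_on_def arrows_def)
qed

lemma transfer_systemD:
  assumes "transfer_system R"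
  shows "R \<subseteq> arrows" and "refl R" and "trans R"
    and "\<And>x y z. (x, y) \<in> R \<Longrightarrow> z \<le> y \<Longrightarrow> (inf x z, z) \<in> R"
  using assms by (auto simp: transfer_system_def partial_order_on_def preorder_on_def arrows_def)

lemma cotransfer_systemD:
  assumes "cotransfer_system R"
  shows "R \<subseteq> arrows" and "refl R" and "trans R"
    and "\<And>x y z. (x, y) \<in> R \<Longrightarrow> x \<le> z \<Longrightarrow> (z, sup y z) \<in> R"
  using assms by (auto simp: cotransfer_system_def partial_order_on_def preorder_on_def arrows_def)

lemma transfer_system_RLP: "transfer_system (RLP S)"
proof (rule transfer_systemI)
  show "RLP S \<subseteq> arrows"
    by (rule RLP_subset_arrows)
  show "refl (RLP S)"
    by (auto simp: RLP_def arrows_def intro!: refl_onI)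
  show "trans (RLP S)"
  proof (rule transI)
    fix x y z assume xyz: "(x, y) \<in> RLP S" "(y, z) \<in> RLP S"
    then have "x \<le> y" and "y \<le> z"
      by (auto simp: RLP_def arrows_def)
    moreover have "has_lift i (x, z)" if "i \<in> S" for i
    proof -
      have "has_lift i (x, y)" and "has_lift i (y, z)"
        using xyz that by (auto simp: RLP_def)
      with \<open>x \<le> y\<close> show ?thesis
        by (cases i) (auto dest: order.trans)
    qed
    ultimately show "(x, z) \<in> RLP S"
      by (auto simp: RLP_def arrows_def simp del: has_lift.simps)
  qed
  show "(inf x z, z) \<in> RLP S" if "(x, y) \<in> RLP S" and "z \<le> y" for x y z
  proof -
    have "b \<le> inf x z" if "(a, b) \<in> S" and "a \<le> inf x z" and "b \<le> z" for a b
    proof -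
      have "has_lift (a, b) (x, y)"
        using \<open>(x, y) \<in> RLP S\<close> that(1) by (auto simp: RLP_def)
      moreover have "a \<le> x" and "b \<le> y"
        using that \<open>z \<le> y\<close> by (auto intro: order.trans)
      ultimately show ?thesis
        using that(3) by simp
    qed
    then show ?thesis
      by (auto simp: RLP_def arrows_def)
  qed
qed

lemma cotransfer_system_LLP: "cotransfer_system (LLP S)"
proof (rule cotransfer_systemI)
  show "LLP S \<subseteq> arrows"
    by (rule LLP_subset_arrows)
  show "refl (LLP S)"
    by (auto simp: LLP_def arrows_def intro!: refl_onI)
  show "trans (LLP S)"
  proof (rule transI)
    fix x y z assume xyz: "(x, y) \<in> LLP S" "(y, z) \<in> LLP S"
    then have "x \<le> y" and "y \<le> z"
      by (auto simp: LLP_def arrows_def)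
    moreover have "has_lift (x, z) p" if "p \<in> S" for p
    proof -
      have "has_lift (x, y) p" and "has_lift (y, z) p"
        using xyz that by (auto simp: LLP_def)
      with \<open>y \<le> z\<close> show ?thesis
        by (cases p) (auto dest: order.trans)
    qed
    ultimately show "(x, z) \<in> LLP S"
      by (auto simp: LLP_def arrows_def simp del: has_lift.simps)
  qed
  show "(z, sup y z) \<in> LLP S" if "(x, y) \<in> LLP S" and "x \<le> z" for x y z
  proof -
    have "sup y z \<le> c" if "(c, d) \<in> S" and "z \<le> c" and "sup y z \<le> d" for c d
    proof -
      have "has_lift (x, y) (c, d)"
        using \<open>(x, y) \<in> LLP S\<close> that(1) by (auto simp: LLP_def)
      moreover have "x \<le> c" and "y \<le> d"
        using that \<open>x \<le> z\<close> by (auto intro: order.trans)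
      ultimately show ?thesis
        using that(2) by simp
    qed
    then show ?thesis
      by (auto simp: LLP_def arrows_def)
  qed
qed

section \<open>The factorization attached to a (co)transfer system\<close>

text \<open>
  The usual argument exhibits an arrow with the lifting property as a retract of one factor of its
  factorization; in a poset the retraction forces the other factor to be an identity.
\<close>

lemma retract_argument:
  assumes "L \<subseteq> arrows" and "R \<subseteq> arrows" and "W \<subseteq> L O R"
  shows "LLP R \<inter> W \<subseteq> L" and "RLP L \<inter> W \<subseteq> R"
proof -
  show "LLP R \<inter> W \<subseteq> L"
  proof
    fix f assume f: "f \<in> LLP R \<inter> W"
    then obtain a m b where m: "f = (a, b)" "(a, m) \<in> L" "(m, b) \<in> R"
      using assms(3) by blast
    then have "has_lift (a, b) (m, b)"
      using f by (auto simp: LLP_def)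
    then have "m = b"
      using assms m by (auto simp: arrows_def intro: antisym)
    with m show "f \<in> L" by simp
  qed
  show "RLP L \<inter> W \<subseteq> R"
  proof
    fix f assume f: "f \<in> RLP L \<inter> W"
    then obtain a m b where m: "f = (a, b)" "(a, m) \<in> L" "(m, b) \<in> R"
      using assms(3) by blast
    then have "has_lift (a, m) (a, b)"
      using f by (auto simp: RLP_def)
    then have "m = a"
      using assms m by (auto simp: arrows_def intro: antisym)
    with m show "f \<in> R" by simp
  qed
qed

text \<open>
  The middle object of the factorization is a minimal \<open>m \<ge> a\<close> from which \<open>b\<close> can be reached by an
  arrow of \<open>T\<close>: a lifting problem against \<open>T\<close> pulls back to an arrow of \<open>T\<close> into \<open>m\<close> from
  an object that is still above \<open>a\<close>, and that object cannot be strictly smaller than \<open>m\<close>.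
\<close>

lemma transfer_system_factorization:
  fixes T :: "('a::{finite, lattice}) rel"
  assumes T: "transfer_system T" and "a \<le> b"
  obtains m where "(a, m) \<in> LLP T" and "(m, b) \<in> T"
proof -
  let ?M = "{m. a \<le> m \<and> (m, b) \<in> T}"
  have "b \<in> ?M"
    using \<open>a \<le> b\<close> transfer_systemD(2)[OF T] by (auto dest: refl_onD)
  then obtain m where m: "m \<in> ?M" and minimal: "\<And>k. k \<in> ?M \<Longrightarrow> k \<le> m \<Longrightarrow> m = k"
    using finite_has_minimal[of ?M] by auto
  have "m \<le> x" if "(x, y) \<in> T" and "a \<le> x" and "m \<le> y" for x y
  proof -
    have "(inf x m, b) \<in> T"
      using transfer_systemD(4)[OF T that(1,3)] m transfer_systemD(3)[OF T] by (auto dest: transD)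
    then have "m = inf x m"
      using m that by (intro minimal) auto
    then show ?thesis
      by (metis inf_le1)
  qed
  then have "(a, m) \<in> LLP T"
    using m by (auto simp: LLP_def arrows_def)
  with m show thesis
    by (auto intro: that)
qed

lemma cotransfer_system_factorization:
  fixes K :: "('a::{finite, lattice}) rel"
  assumes K: "cotransfer_system K" and "a \<le> b"
  obtains m where "(a, m) \<in> K" and "(m, b) \<in> RLP K"
proof -
  let ?M = "{m. m \<le> b \<and> (a, m) \<in> K}"
  have "a \<in> ?M"
    using \<open>a \<le> b\<close> cotransfer_systemD(2)[OF K] by (auto dest: refl_onD)
  then obtain m where m: "m \<in> ?M" and maximal: "\<And>k. k \<in> ?M \<Longrightarrow> m \<le> k \<Longrightarrow> m = k"
    using finite_has_maximal[of ?M] by auto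
  have "y \<le> m" if "(x, y) \<in> K" and "x \<le> m" and "y \<le> b" for x y
  proof -
    have "(a, sup y m) \<in> K"
      using cotransfer_systemD(4)[OF K that(1,2)] m cotransfer_systemD(3)[OF K] by (auto dest: transD)
    then have "m = sup y m"
      using m that by (intro maximal) auto
    then show ?thesis
      by (metis sup_ge1)
  qed
  then have "(m, b) \<in> RLP K"
    using m by (auto simp: RLP_def arrows_def)
  with m show thesis
    by (auto intro: that)
qed

lemma weak_factorization_system_LLP:
  fixes T :: "('a::{finite, lattice}) rel"
  assumes T: "transfer_system T"
  shows "weak_factorization_system (LLP T) T"
proof -
  have factor: "arrows \<subseteq> LLP T O T"
    by (auto simp: arrows_def elim: transfer_system_factorization[OF T])
  have "T \<subseteq> RLP (LLP T)"
    using subset_RLP_iff_subset_LLP[OF LLP_subset_arrows transfer_systemD(1)[OF T]] by blast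
  moreover have "RLP (LLP T) \<subseteq> T"
    using retract_argument(2)[OF LLP_subset_arrows transfer_systemD(1)[OF T] factor]
      RLP_subset_arrows by blast
  ultimately show ?thesis
    using factor unfolding weak_factorization_system_def by blast
qed

lemma weak_factorization_system_RLP:
  fixes K :: "('a::{finite, lattice}) rel"
  assumes K: "cotransfer_system K"
  shows "weak_factorization_system K (RLP K)"
proof -
  have factor: "arrows \<subseteq> K O RLP K"
    by (auto simp: arrows_def elim: cotransfer_system_factorization[OF K])
  have "K \<subseteq> LLP (RLP K)"
    using subset_RLP_iff_subset_LLP[OF cotransfer_systemD(1)[OF K] RLP_subset_arrows] by blast
  moreover have "LLP (RLP K) \<subseteq> K"
    using retract_argument(1)[OF cotransfer_systemD(1)[OF K] RLP_subset_arrows factor]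
      LLP_subset_arrows by blast
  ultimately show ?thesis
    using factor unfolding weak_factorization_system_def by blast
qed

section \<open>Joins of (co)transfer systems\<close>

text \<open>
  A chain of arrows is pulled back link by link: the pullback of its last link is an arrow into \<open>z\<close>,
  along whose source the rest of the chain is pulled back.
\<close>

lemma transfer_system_trancl_Union:
  fixes \<S> :: "('a::lattice) rel set"
  assumes S: "\<And>T. T \<in> \<S> \<Longrightarrow> transfer_system T" and "\<S> \<noteq> {}"
  shows "transfer_system ((\<Union>\<S>)\<^sup>+)"
proof (rule transfer_systemI)
  have arr: "\<Union>\<S> \<subseteq> arrows"
    using S transfer_systemD(1) by blast
  have "arrows\<^sup>+ = (arrows :: 'a rel)"
    by (intro trancl_id transI) (auto simp: arrows_def)
  with trancl_mono_subset[OF arr] show "(\<Union>\<S>)\<^sup>+ \<subseteq> arrows"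
    by simp
  obtain T where "T \<in> \<S>" and "refl T"
    using assms transfer_systemD(2) by blast
  then have "(x, x) \<in> \<Union>\<S>" for x
    by (auto dest: refl_onD)
  then show "refl ((\<Union>\<S>)\<^sup>+)"
    by (intro refl_onI r_into_trancl)
  show "(inf x z, z) \<in> (\<Union>\<S>)\<^sup>+" if "(x, y) \<in> (\<Union>\<S>)\<^sup>+" and "z \<le> y" for x y z
    using that
  proof (induction rule: converse_trancl_induct)
    case (base w)
    then show ?case
      using S transfer_systemD(4) by blast
  next
    case (step v w)
    \<comment> \<open>The arrow from \<open>v\<close> to \<open>w\<close> is pulled back along \<open>inf w z \<le> w\<close>.\<close>
    have "(inf v (inf w z), inf w z) \<in> \<Union>\<S>"
      using step.hyps(1) S transfer_systemD(4) inf_le1 by blast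
    moreover have "inf v (inf w z) = inf v z"
      using step.hyps(1) arr by (auto simp: arrows_def inf.assoc[symmetric] inf.absorb1)
    ultimately show ?case
      using step.IH step.prems by (auto intro: trancl_into_trancl2)
  qed
qed (rule trans_trancl)

lemma cotransfer_system_trancl_Union:
  fixes \<S> :: "('a::lattice) rel set"
  assumes S: "\<And>K. K \<in> \<S> \<Longrightarrow> cotransfer_system K" and "\<S> \<noteq> {}"
  shows "cotransfer_system ((\<Union>\<S>)\<^sup>+)"
proof (rule cotransfer_systemI)
  have arr: "\<Union>\<S> \<subseteq> arrows"
    using S cotransfer_systemD(1) by blast
  have "arrows\<^sup>+ = (arrows :: 'a rel)"
    by (intro trancl_id transI) (auto simp: arrows_def)
  with trancl_mono_subset[OF arr] show "(\<Union>\<S>)\<^sup>+ \<subseteq> arrows"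
    by simp
  obtain K where "K \<in> \<S>" and "refl K"
    using assms cotransfer_systemD(2) by blast
  then have "(x, x) \<in> \<Union>\<S>" for x
    by (auto dest: refl_onD)
  then show "refl ((\<Union>\<S>)\<^sup>+)"
    by (intro refl_onI r_into_trancl)
  show "(z, sup y z) \<in> (\<Union>\<S>)\<^sup>+" if "(x, y) \<in> (\<Union>\<S>)\<^sup>+" and "x \<le> z" for x y z
    using that
  proof (induction rule: trancl_induct)
    case (base w)
    then show ?case
      using S cotransfer_systemD(4) by blast
  next
    case (step v w)
    \<comment> \<open>The arrow from \<open>v\<close> to \<open>w\<close> is pushed out along \<open>v \<le> sup v z\<close>.\<close>
    have "(sup v z, sup w (sup v z)) \<in> \<Union>\<S>"
      using step.hyps(2) S cotransfer_systemD(4) sup_ge1 by blast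
    moreover have "sup w (sup v z) = sup w z"
      using step.hyps(2) arr by (auto simp: arrows_def sup.assoc[symmetric] sup.absorb1)
    ultimately show ?case
      using step.IH step.prems by (auto intro: trancl_into_trancl)
  qed
qed (rule trans_trancl)

lemma transfer_join_eq_trancl:
  assumes "\<And>T. T \<in> \<S> \<Longrightarrow> transfer_system T" and "\<S> \<noteq> {}"
  shows "transfer_join \<S> = (\<Union>\<S>)\<^sup>+"
proof
  have "\<Union>\<S> \<subseteq> (\<Union>\<S>)\<^sup>+"
    by (rule subsetI) (rule r_into_trancl')
  with transfer_system_trancl_Union[OF assms] show "transfer_join \<S> \<subseteq> (\<Union>\<S>)\<^sup>+"
    unfolding transfer_join_def by (intro Inter_lower CollectI conjI)
  show "(\<Union>\<S>)\<^sup>+ \<subseteq> transfer_join \<S>"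
    unfolding transfer_join_def
  proof (rule Inter_greatest)
    fix T assume "T \<in> {T. transfer_system T \<and> \<Union>\<S> \<subseteq> T}"
    then have "trans T" and "\<Union>\<S> \<subseteq> T"
      using transfer_systemD(3) by blast+
    then show "(\<Union>\<S>)\<^sup>+ \<subseteq> T"
      using trancl_mono_subset[of "\<Union>\<S>" T] by (simp add: trancl_id)
  qed
qed

lemma cotransfer_join_eq_trancl:
  assumes "\<And>K. K \<in> \<S> \<Longrightarrow> cotransfer_system K" and "\<S> \<noteq> {}"
  shows "cotransfer_join \<S> = (\<Union>\<S>)\<^sup>+"
proof
  have "\<Union>\<S> \<subseteq> (\<Union>\<S>)\<^sup>+"
    by (rule subsetI) (rule r_into_trancl')
  with cotransfer_system_trancl_Union[OF assms] show "cotransfer_join \<S> \<subseteq> (\<Union>\<S>)\<^sup>+"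
    unfolding cotransfer_join_def by (intro Inter_lower CollectI conjI)
  show "(\<Union>\<S>)\<^sup>+ \<subseteq> cotransfer_join \<S>"
    unfolding cotransfer_join_def
  proof (rule Inter_greatest)
    fix K assume "K \<in> {K. cotransfer_system K \<and> \<Union>\<S> \<subseteq> K}"
    then have "trans K" and "\<Union>\<S> \<subseteq> K"
      using cotransfer_systemD(3) by blast+
    then show "(\<Union>\<S>)\<^sup>+ \<subseteq> K"
      using trancl_mono_subset[of "\<Union>\<S>" K] by (simp add: trancl_id)
  qed
qed

lemma T_max_greatest:
  fixes W :: "('a::lattice) rel"
  assumes "wide_subcategory W"
  shows "transfer_system (T_max W)" and "T_max W \<subseteq> W"
    and "\<And>T. transfer_system T \<Longrightarrow> T \<subseteq> W \<Longrightarrow> T \<subseteq> T_max W"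
proof -
  let ?S = "{T. transfer_system T \<and> T \<subseteq> W}"
  have "transfer_system (Id :: 'a rel)"
    by (rule transfer_systemI) (auto simp: arrows_def refl_Id trans_Id inf_absorb2)
  moreover have "Id \<subseteq> W"
    using assms by (auto simp: wide_subcategory_def dest: refl_onD)
  ultimately have "?S \<noteq> {}"
    by blast
  then have eq: "T_max W = (\<Union>?S)\<^sup>+"
    unfolding T_max_def by (intro transfer_join_eq_trancl) auto
  show "transfer_system (T_max W)"
    unfolding eq using \<open>?S \<noteq> {}\<close> by (intro transfer_system_trancl_Union) auto
  have "(\<Union>?S)\<^sup>+ \<subseteq> W\<^sup>+"
    by (rule trancl_mono_subset) blast
  also have "W\<^sup>+ = W"
    using assms by (simp add: wide_subcategory_def trancl_id)
  finally show "T_max W \<subseteq> W"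
    unfolding eq .
  show "T \<subseteq> T_max W" if "transfer_system T" and "T \<subseteq> W" for T
    using that unfolding T_max_def transfer_join_def by blast
qed

lemma K_max_greatest:
  fixes W :: "('a::lattice) rel"
  assumes "wide_subcategory W"
  shows "cotransfer_system (K_max W)" and "K_max W \<subseteq> W"
    and "\<And>K. cotransfer_system K \<Longrightarrow> K \<subseteq> W \<Longrightarrow> K \<subseteq> K_max W"
proof -
  let ?S = "{K. cotransfer_system K \<and> K \<subseteq> W}"
  have "cotransfer_system (Id :: 'a rel)"
    by (rule cotransfer_systemI) (auto simp: arrows_def refl_Id trans_Id sup_absorb2)
  moreover have "Id \<subseteq> W"
    using assms by (auto simp: wide_subcategory_def dest: refl_onD)
  ultimately have "?S \<noteq> {}"
    by blast
  then have eq: "K_max W = (\<Union>?S)\<^sup>+"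
    unfolding K_max_def by (intro cotransfer_join_eq_trancl) auto
  show "cotransfer_system (K_max W)"
    unfolding eq using \<open>?S \<noteq> {}\<close> by (intro cotransfer_system_trancl_Union) auto
  have "(\<Union>?S)\<^sup>+ \<subseteq> W\<^sup>+"
    by (rule trancl_mono_subset) blast
  also have "W\<^sup>+ = W"
    using assms by (simp add: wide_subcategory_def trancl_id)
  finally show "K_max W \<subseteq> W"
    unfolding eq .
  show "K \<subseteq> K_max W" if "cotransfer_system K" and "K \<subseteq> W" for K
    using that unfolding K_max_def cotransfer_join_def by blast
qed

section \<open>Model structures with prescribed weak equivalences\<close>

text \<open>
  A model structure with weak equivalences \<open>W\<close> is recorded by its acyclic cofibrations \<open>L\<close> and
  acyclic fibrations \<open>R\<close>; the other two classes are \<open>RLP L\<close> and \<open>LLP R\<close>.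
\<close>

definition acyclic_pair :: "('a::lattice) rel \<Rightarrow> 'a rel \<Rightarrow> 'a rel \<Rightarrow> bool" where
  "acyclic_pair W L R \<longleftrightarrow>
     cotransfer_system L \<and> transfer_system R \<and> L = LLP R \<inter> W \<and> R = RLP L \<inter> W"

lemma acyclic_pairD:
  assumes "acyclic_pair W L R"
  shows "cotransfer_system L" and "transfer_system R" and "L = LLP R \<inter> W" and "R = RLP L \<inter> W"
  using assms unfolding acyclic_pair_def by blast+

text \<open>
  Decomposability keeps both halves of a factorization of an arrow of \<open>W\<close> inside \<open>W\<close>.
\<close>

lemma factorization_in_W:
  assumes "W \<subseteq> arrows" and "decomposable W"
    and "weak_factorization_system L R"
  shows "W \<subseteq> (L \<inter> W) O (R \<inter> W)"
proof clarify
  have LR: "arrows \<subseteq> L O R" "L \<subseteq> arrows" "R \<subseteq> arrows"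
    using assms(3) LLP_subset_arrows[of R] RLP_subset_arrows[of L]
    unfolding weak_factorization_system_def by blast+
  fix a b assume ab: "(a, b) \<in> W"
  then obtain m where m: "(a, m) \<in> L" "(m, b) \<in> R"
    using assms(1) LR(1) by blast
  then have "(a, m) \<in> arrows" and "(m, b) \<in> arrows"
    using LR by blast+
  then have "(a, m) \<in> W" and "(m, b) \<in> W"
    using assms(2) ab unfolding decomposable_def by blast+
  with m show "(a, b) \<in> (L \<inter> W) O (R \<inter> W)"
    by blast
qed

lemma two_out_of_three_decomposable:
  "trans W \<Longrightarrow> decomposable W \<Longrightarrow> two_out_of_three W"
  unfolding two_out_of_three_def decomposable_def by (blast dest: transD)

lemma model_structure_iff_acyclic_pair:
  fixes W :: "('a::{finite, lattice}) rel"
  assumes W: "wide_subcategory W" "decomposable W"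
  shows "(\<exists>F C. model_structure L F C R \<and> weak_equivalences L R = W) \<longleftrightarrow> acyclic_pair W L R"
proof
  assume "\<exists>F C. model_structure L F C R \<and> weak_equivalences L R = W"
  then obtain F C where wfs: "L = LLP F" "C = LLP R" "R = RLP C" and "L \<subseteq> C" and LR: "L O R = W"
    unfolding model_structure_def weak_factorization_system_def weak_equivalences_def by blast
  have L: "cotransfer_system L" and R: "transfer_system R"
    using wfs(1,3) cotransfer_system_LLP[of F] transfer_system_RLP[of C] by metis+
  note arr = cotransfer_systemD(1)[OF L] transfer_systemD(1)[OF R]
  have "L \<subseteq> L O R" and "R \<subseteq> L O R"
    using cotransfer_systemD(2)[OF L] transfer_systemD(2)[OF R] by (auto dest: refl_onD)
  moreover have "L \<subseteq> LLP R" and "R \<subseteq> RLP L"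
    using \<open>L \<subseteq> C\<close> wfs(2) subset_RLP_iff_subset_LLP[OF arr] by blast+
  ultimately show "acyclic_pair W L R"
    using L R LR retract_argument[OF arr, of W] unfolding acyclic_pair_def by blast
next
  assume pair: "acyclic_pair W L R"
  then have R: "weak_factorization_system (LLP R) R" and L: "weak_factorization_system L (RLP L)"
    by (blast intro: acyclic_pairD weak_factorization_system_LLP weak_factorization_system_RLP)+
  note LW = acyclic_pairD(3)[OF pair] and RW = acyclic_pairD(4)[OF pair]
  have "W \<subseteq> arrows" and "trans W"
    using W(1) by (simp_all add: wide_subcategory_def)
  then have "W \<subseteq> (LLP R \<inter> W) O (R \<inter> W)"
    using factorization_in_W[OF _ W(2) R] by blast
  then have "W \<subseteq> L O R"
    using LW by blast
  moreover have "L O R \<subseteq> W"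
    using LW RW \<open>trans W\<close> by (blast dest: transD)
  ultimately have "weak_equivalences L R = W"
    unfolding weak_equivalences_def by blast
  moreover have "L \<subseteq> LLP R"
    using LW by blast
  ultimately have "model_structure L (RLP L) (LLP R) R \<and> weak_equivalences L R = W"
    using L R two_out_of_three_decomposable[OF \<open>trans W\<close> W(2)] unfolding model_structure_def
    by blast
  then show "\<exists>F C. model_structure L F C R \<and> weak_equivalences L R = W"
    by blast
qed

lemma AF_set_eq:
  fixes W :: "('a::{finite, lattice}) rel"
  assumes "wide_subcategory W" and "decomposable W"
  shows "AF_set W = {R. \<exists>L. acyclic_pair W L R}"
  unfolding AF_set_def model_structure_iff_acyclic_pair[OF assms] by (blast dest: acyclic_pairD)

lemma AC_set_eq:
  fixes W :: "('a::{finite, lattice}) rel"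
  assumes "wide_subcategory W" and "decomposable W"
  shows "AC_set W = {L. \<exists>R. acyclic_pair W L R}"
proof -
  have "(\<exists>F C R. model_structure L F C R \<and> weak_equivalences L R = W) \<longleftrightarrow> (\<exists>R. acyclic_pair W L R)"
    for L
    using model_structure_iff_acyclic_pair[OF assms, of L] by blast
  then show ?thesis
    unfolding AC_set_def by (blast dest: acyclic_pairD)
qed

text \<open>
  A larger transfer system leaves fewer acyclic cofibrations. Being a subclass of \<open>L\<close>, the
  class \<open>LLP T \<inter> W\<close> has its pushouts in \<open>L \<subseteq> W\<close>, and \<open>LLP T\<close> is
  closed under pushouts anyway.
\<close>

lemma acyclic_pair_enlarge_transfer:
  fixes W :: "('a::{finite, lattice}) rel"
  assumes W: "wide_subcategory W" "decomposable W"
    and pair: "acyclic_pair W L R" and T: "transfer_system T" "R \<subseteq> T" "T \<subseteq> W"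
  shows "acyclic_pair W (LLP T \<inter> W) T"
proof -
  let ?L = "LLP T \<inter> W"
  note L = acyclic_pairD(1,3)[OF pair]
  note LLP_T = cotransfer_systemD[OF cotransfer_system_LLP[of T]]
  have cotransfer: "cotransfer_system ?L"
  proof (rule cotransfer_systemI)
    show "(z, sup y z) \<in> ?L" if "(x, y) \<in> ?L" and "x \<le> z" for x y z
    proof -
      have "(x, y) \<in> L"
        using that L(2) LLP_antimono[OF T(2)] by blast
      then have "(z, sup y z) \<in> W"
        using cotransfer_systemD(4)[OF L(1) _ that(2)] L(2) by blast
      with that LLP_T(4) show ?thesis
        by blast
    qed
  qed (use LLP_T W(1) in \<open>auto simp: wide_subcategory_def intro!: refl_onI trans_Int dest: refl_onD\<close>)
  have "W \<subseteq> ?L O (T \<inter> W)"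
    using factorization_in_W[OF _ W(2) weak_factorization_system_LLP[OF T(1)]] W(1)
    by (simp add: wide_subcategory_def)
  then have "RLP ?L \<inter> W \<subseteq> T"
    using cotransfer_systemD(1)[OF cotransfer] transfer_systemD(1)[OF T(1)]
    by (intro retract_argument(2)) auto
  moreover have "T \<subseteq> RLP ?L"
    using subset_RLP_iff_subset_LLP[OF cotransfer_systemD(1)[OF cotransfer] transfer_systemD(1)[OF T(1)]]
    by blast
  ultimately show ?thesis
    using cotransfer T unfolding acyclic_pair_def by blast
qed

lemma acyclic_pair_enlarge_cotransfer:
  fixes W :: "('a::{finite, lattice}) rel"
  assumes W: "wide_subcategory W" "decomposable W"
    and pair: "acyclic_pair W L R" and K: "cotransfer_system K" "L \<subseteq> K" "K \<subseteq> W"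
  shows "acyclic_pair W K (RLP K \<inter> W)"
proof -
  let ?R = "RLP K \<inter> W"
  note R = acyclic_pairD(2,4)[OF pair]
  note RLP_K = transfer_systemD[OF transfer_system_RLP[of K]]
  have transfer: "transfer_system ?R"
  proof (rule transfer_systemI)
    show "(inf x z, z) \<in> ?R" if "(x, y) \<in> ?R" and "z \<le> y" for x y z
    proof -
      have "(x, y) \<in> R"
        using that R(2) RLP_antimono[OF K(2)] by blast
      then have "(inf x z, z) \<in> W"
        using transfer_systemD(4)[OF R(1) _ that(2)] R(2) by blast
      with that RLP_K(4) show ?thesis
        by blast
    qed
  qed (use RLP_K W(1) in \<open>auto simp: wide_subcategory_def intro!: refl_onI trans_Int dest: refl_onD\<close>)
  have "W \<subseteq> (K \<inter> W) O ?R"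
    using factorization_in_W[OF _ W(2) weak_factorization_system_RLP[OF K(1)]] W(1)
    by (simp add: wide_subcategory_def)
  then have "LLP ?R \<inter> W \<subseteq> K"
    using transfer_systemD(1)[OF transfer] cotransfer_systemD(1)[OF K(1)]
    by (intro retract_argument(1)) auto
  moreover have "K \<subseteq> LLP ?R"
    using subset_RLP_iff_subset_LLP[OF cotransfer_systemD(1)[OF K(1)] transfer_systemD(1)[OF transfer]]
    by blast
  ultimately show ?thesis
    using transfer K unfolding acyclic_pair_def by blast
qed

section \<open>Extremal acyclic fibrations and cofibrations\<close>

theorem corollary4p26:
  fixes W :: "('a::{finite, lattice}) rel"
  assumes "weak_equivalence_set W"
  shows "(AF_min W = RLP (K_max W) \<inter> W \<and> AC_min W = LLP (T_max W) \<inter> W) \<and>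
    (T_max W = RLP (AC_min W) \<inter> W \<and> K_max W = LLP (AF_min W) \<inter> W)"
proof -
  have W: "wide_subcategory W" "decomposable W"
    using assms unfolding weak_equivalence_set_def by blast+
  obtain L R where pair: "acyclic_pair W L R"
    using assms model_structure_iff_acyclic_pair[OF W] unfolding weak_equivalence_set_def by blast
  note T_max = T_max_greatest[OF W(1)] and K_max = K_max_greatest[OF W(1)]
  have below: "L' \<subseteq> K_max W \<and> R' \<subseteq> T_max W" if "acyclic_pair W L' R'" for L' R'
    using that T_max(3)[of R'] K_max(3)[of L'] unfolding acyclic_pair_def by blast
  have T: "acyclic_pair W (LLP (T_max W) \<inter> W) (T_max W)"
    using acyclic_pair_enlarge_transfer[OF W pair] T_max(1,2) below[OF pair] by blast
  have K: "acyclic_pair W (K_max W) (RLP (K_max W) \<inter> W)"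
    using acyclic_pair_enlarge_cotransfer[OF W pair] K_max(1,2) below[OF pair] by blast
  have "RLP (K_max W) \<inter> W \<subseteq> R'" if "acyclic_pair W L' R'" for L' R'
    using that below[OF that] RLP_antimono[of L' "K_max W"] unfolding acyclic_pair_def by blast
  then have AF: "AF_min W = RLP (K_max W) \<inter> W"
    unfolding AF_min_def AF_set_eq[OF W] using K by blast
  have "LLP (T_max W) \<inter> W \<subseteq> L'" if "acyclic_pair W L' R'" for L' R'
    using that below[OF that] LLP_antimono[of R' "T_max W"] unfolding acyclic_pair_def by blast
  then have AC: "AC_min W = LLP (T_max W) \<inter> W"
    unfolding AC_min_def AC_set_eq[OF W] using T by blast
  show ?thesis
    using AF AC acyclic_pairD(4)[OF T] acyclic_pairD(3)[OF K] by metis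
qed

end
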